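(* Let $X$ be a first countable, Hausdorff topological vector space over $\mathbb{K}$ ($=\mathbb{R}$ or $\mathbb{C}$), let $\mu$ be a non-zero measure on the Borel $\sigma$-algebra of $X$ that is finite on bounded sets, and let $K\subset X$ be a bounded, open neighbourhood of the origin. If $E\subset X$ is topologically dense in $X$, then a point $u \in X$ is an $E$-strong mode of $\mu$ if and only if $u$ is a strong mode of $\mu$.
   Context: For $x\in X$ and real $r>0$, put $K(x,r)=x+rK$ and $f(x,r)=\mu(K(x,r))\in[0,\infty)$. For $E\subset X$, $u-E=\{u-v : v\in E\}$. $\operatorname{supp}(\mu)$ is the set of points all of whose open neighbourhoods have positive $\mu$-measure. Suprema take values in $[0,\infty]$, and a ratio with denominator $0$ is taken to be $+\infty$ (so that $0/0$ never counts as satisfying a mode condition). A strong mode of $\mu$ is any $u\in X$ with $\lim_{r\downarrow 0}\frac{\sup_{z\in X} f(z,r)}{f(u,r)}=1$. An $E$-strong mode of $\mu$ is any $u\in\operatorname{supp}(\mu)$ with $\limsup_{r\downarrow 0}\frac{\sup_{z\in u-E} f(z,r)}{f(u,r)}\le 1$. *)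

theory Defs
  imports "HOL-Analysis.Analysis"
begin

(* A topological vector space over R or C. The scalar field is an arbitrary type of class
   real_normed_field (a commutative field with a multiplicative norm over the reals, carrying the
   norm topology). By Gelfand-Mazur every such field is isometrically isomorphic to R or to C,
   both of which are instances, so the class describes exactly these two fields.
   Continuity of addition comes from the class topological_ab_group_add. *)
locale topological_vector_space = vector_space scl
  for scl :: "'k::real_normed_field \<Rightarrow> 'a::topological_ab_group_add \<Rightarrow> 'a" +
  assumes continuous_scale: "continuous_on UNIV (\<lambda>(c, x). scl c x)"

(* Boundedness in the sense of topological vector spaces (absorbed by every neighbourhood of the
   origin); the library's "bounded" is metric boundedness. *)
definition tvs_bounded ::
  "('k::real_normed_field \<Rightarrow> 'a::topological_ab_group_add \<Rightarrow> 'a) \<Rightarrow> 'a set \<Rightarrow> bool" where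
  "tvs_bounded scl B \<longleftrightarrow>
     (\<forall>U. open U \<and> 0 \<in> U \<longrightarrow> (\<exists>s>0. \<forall>c. norm c > s \<longrightarrow> B \<subseteq> scl c ` U))"

definition dilate ::
  "('k::real_normed_field \<Rightarrow> 'a::topological_ab_group_add \<Rightarrow> 'a) \<Rightarrow> 'a set \<Rightarrow> 'a \<Rightarrow> real \<Rightarrow> 'a set" where
  "dilate scl K x r = (\<lambda>v. x + scl (of_real r) v) ` K"

definition ball_mass ::
  "('k::real_normed_field \<Rightarrow> 'a::topological_ab_group_add \<Rightarrow> 'a) \<Rightarrow> 'a set \<Rightarrow> 'a measure \<Rightarrow> 'a \<Rightarrow> real \<Rightarrow> ennreal" where
  "ball_mass scl K \<mu> x r = emeasure \<mu> (dilate scl K x r)"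

(* Division in ennreal has 0 / 0 = 0; here a ratio with denominator 0 is infinity. *)
definition mode_ratio :: "ennreal \<Rightarrow> ennreal \<Rightarrow> ennreal" where
  "mode_ratio a b = (if b = 0 then \<infinity> else a / b)"

definition msupp :: "'a::topological_space measure \<Rightarrow> 'a set" where
  "msupp \<mu> = {x. \<forall>U. open U \<and> x \<in> U \<longrightarrow> emeasure \<mu> U > 0}"

definition strong_mode ::
  "('k::real_normed_field \<Rightarrow> 'a::topological_ab_group_add \<Rightarrow> 'a) \<Rightarrow> 'a set \<Rightarrow> 'a measure \<Rightarrow> 'a \<Rightarrow> bool" where
  "strong_mode scl K \<mu> u \<longleftrightarrow>
     ((\<lambda>r. mode_ratio (SUP z. ball_mass scl K \<mu> z r) (ball_mass scl K \<mu> u r)) \<longlongrightarrow> 1) (at_right 0)"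

definition E_strong_mode ::
  "('k::real_normed_field \<Rightarrow> 'a::topological_ab_group_add \<Rightarrow> 'a) \<Rightarrow> 'a set \<Rightarrow> 'a measure \<Rightarrow> 'a set \<Rightarrow> 'a \<Rightarrow> bool" where
  "E_strong_mode scl K \<mu> E u \<longleftrightarrow>
     u \<in> msupp \<mu> \<and>
     Limsup (at_right 0)
       (\<lambda>r. mode_ratio (SUP z\<in>(\<lambda>v. u - v) ` E. ball_mass scl K \<mu> z r) (ball_mass scl K \<mu> u r)) \<le> 1"

end

theory Submission
  imports Defs
begin

text \<open>
  Write \<open>f z r\<close> for the mass of \<open>z + r K\<close>.  The function \<open>f _ r\<close> is lower semicontinuous: if
  \<open>z n \<longlonglongrightarrow> x\<close>, then every point of the open set \<open>x + r K\<close> lies in \<open>z n + r K\<close> for all large \<open>n\<close>, so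
  Fatou's lemma for sets bounds \<open>f x r\<close> by the supremum of the masses \<open>f (z n) r\<close>
  (\<open>emeasure_translate_le_SUP\<close>).  In a first countable space
  every point is a limit of a sequence from a given dense set, hence the supremum of \<open>f _ r\<close> over
  the dense set \<open>u - E\<close> is its supremum over the whole space (\<open>SUP_translates_dense\<close>).  The
  ratios in the two notions of mode are therefore the same function \<open>q\<close> of \<open>r\<close>.

  It remains to compare two conditions as \<open>r\<close> decreases to \<open>0\<close>: that \<open>q\<close> tends to \<open>1\<close>, and that
  \<open>limsup q \<le> 1\<close> with \<open>u\<close> in the support.  Here the boundedness of \<open>K\<close> enters twice.  The sets
  \<open>u + r K\<close> are bounded (\<open>tvs_bounded_dilate\<close>), so \<open>f u r\<close> is finite and \<open>q \<ge> 1\<close>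
  (\<open>mode_ratio_ge_1\<close>); thus \<open>limsup q \<le> 1\<close> already forces convergence.  They also shrink into
  every neighbourhood of \<open>u\<close> (\<open>eventually_dilate_subset\<close>); if \<open>q\<close> tends to \<open>1\<close>, the denominators
  \<open>f u r\<close> are positive for small \<open>r\<close>, so every such neighbourhood has positive mass.
\<close>

section \<open>Masses of translates of an open set\<close>

lemma open_translate:
  fixes D :: "'a::topological_ab_group_add set"
  assumes "open D"
  shows "open ((+) x ` D)"
proof -
  have "(+) x ` D = (\<lambda>w. w - x) -` D"
  proof (intro equalityI subsetI)
    fix w assume "w \<in> (\<lambda>w. w - x) -` D"
    then show "w \<in> (+) x ` D" by (intro image_eqI[where x = "w - x"]) auto
  qed auto
  moreover have "open ((\<lambda>w. w - x) -` D)"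
    by (rule open_vimage[OF assms]) (intro continuous_intros)
  ultimately show ?thesis by simp
qed

text \<open>
  Lower semicontinuity of the mass of a translate.  Continuity of the measure from below
  applies to the increasing sets \<open>\<Inter>m\<ge>n. z m + D\<close>; their union contains \<open>x + D\<close> because for \<open>w \<in> x + D\<close> the points
  \<open>w - z n\<close> converge to \<open>w - x\<close>, which lies in the open set \<open>D\<close>.
\<close>
lemma emeasure_translate_le_SUP:
  fixes D :: "'a::topological_ab_group_add set" and \<mu> :: "'a measure"
  assumes sets: "sets \<mu> = sets borel" and "open D" and z: "z \<longlonglongrightarrow> x"
  shows "emeasure \<mu> ((+) x ` D) \<le> (SUP n. emeasure \<mu> ((+) (z n) ` D))"
proof -
  define A where "A n = (\<Inter>m\<in>{n..}. (+) (z m) ` D)" for n :: nat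
  have meas: "(+) y ` D \<in> sets \<mu>" for y
    using open_translate[OF \<open>open D\<close>] by (simp add: sets)
  have A: "A n \<in> sets \<mu>" for n
    unfolding A_def by (intro sets.countable_INT') (auto simp: meas)
  have inc: "incseq A"
    by (auto simp: A_def incseq_def)
  have sub: "(+) x ` D \<subseteq> (\<Union>n. A n)"
  proof
    fix w assume "w \<in> (+) x ` D"
    then have w: "w - x \<in> D" by auto
    have "(\<lambda>n. w - z n) \<longlonglongrightarrow> w - x"
      by (intro tendsto_intros z)
    then have "\<forall>\<^sub>F n in sequentially. w - z n \<in> D"
      using \<open>open D\<close> w by (rule topological_tendstoD)
    then obtain n where n: "\<And>m. m \<ge> n \<Longrightarrow> w - z m \<in> D"
      by (auto simp: eventually_sequentially)
    have "w \<in> (+) (z m) ` D" if "m \<ge> n" for m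
      using n[OF that] by (intro image_eqI[where x = "w - z m"]) auto
    then show "w \<in> (\<Union>n. A n)" by (auto simp: A_def)
  qed
  have "emeasure \<mu> ((+) x ` D) \<le> emeasure \<mu> (\<Union>n. A n)"
    using sub A by (intro emeasure_mono) auto
  also have "\<dots> = (SUP n. emeasure \<mu> (A n))"
    using A inc by (intro SUP_emeasure_incseq[symmetric]) auto
  also have "\<dots> \<le> (SUP n. emeasure \<mu> ((+) (z n) ` D))"
    by (intro SUP_mono) (use meas in \<open>auto intro!: emeasure_mono simp: A_def\<close>)
  finally show ?thesis .
qed

lemma SUP_translates_dense:
  fixes D :: "'a::{topological_ab_group_add, first_countable_topology} set"
    and \<mu> :: "'a measure"
  assumes "sets \<mu> = sets borel" and "open D" and S: "closure S = UNIV"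
  shows "(SUP x. emeasure \<mu> ((+) x ` D)) = (SUP x\<in>S. emeasure \<mu> ((+) x ` D))"
proof (rule antisym)
  show "(SUP x. emeasure \<mu> ((+) x ` D)) \<le> (SUP x\<in>S. emeasure \<mu> ((+) x ` D))"
  proof (rule SUP_least)
    fix x
    from S have "x \<in> closure S" by simp
    then obtain z where z: "\<And>n. z n \<in> S" "z \<longlonglongrightarrow> x"
      by (auto simp: closure_sequential)
    have "emeasure \<mu> ((+) x ` D) \<le> (SUP n. emeasure \<mu> ((+) (z n) ` D))"
      by (rule emeasure_translate_le_SUP) (use assms z in auto)
    also have "\<dots> \<le> (SUP x\<in>S. emeasure \<mu> ((+) x ` D))"
      using z(1) by (intro SUP_least SUP_upper)
    finally show "emeasure \<mu> ((+) x ` D) \<le> \<dots>" .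
  qed
qed (intro SUP_subset_mono; simp)

lemma closure_reflect:
  fixes E :: "'a::topological_ab_group_add set"
  assumes "closure E = UNIV"
  shows "closure ((\<lambda>v. u - v) ` E) = UNIV"
proof -
  have "(\<lambda>v. u - v) ` closure E \<subseteq> closure ((\<lambda>v. u - v) ` E)"
    by (rule continuous_image_closure_subset[where A = UNIV]) (auto intro!: continuous_intros)
  moreover have "range (\<lambda>v. u - v) = UNIV"
    by (rule surjI[where f = "\<lambda>v. u - v"]) simp
  ultimately show ?thesis using assms by auto
qed

section \<open>Dilates of open and of bounded sets\<close>

lemma dilate_eq_translate: "dilate scl K x r = (+) x ` (\<lambda>v. scl (of_real r) v) ` K"
  by (auto simp: dilate_def image_image)

context topological_vector_space
begin

lemma continuous_on_scale_right: "continuous_on A (\<lambda>x. scl c x)"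
proof -
  have "continuous_on A (\<lambda>x. (\<lambda>(c, x). scl c x) (c, x))"
    by (rule continuous_on_compose2[OF continuous_scale]) (auto intro!: continuous_intros)
  then show ?thesis by simp
qed

lemma continuous_on_scale_left: "continuous_on A (\<lambda>c. scl c x)"
proof -
  have "continuous_on A (\<lambda>c. (\<lambda>(c, x). scl c x) (c, x))"
    by (rule continuous_on_compose2[OF continuous_scale]) (auto intro!: continuous_intros)
  then show ?thesis by simp
qed

lemma open_scale:
  assumes "open D" "c \<noteq> 0"
  shows "open (scl c ` D)"
proof -
  have "scl c ` D = scl (inverse c) -` D"
  proof (intro equalityI subsetI)
    fix w assume "w \<in> scl (inverse c) -` D"
    then show "w \<in> scl c ` D"
      using \<open>c \<noteq> 0\<close> by (intro image_eqI[where x = "scl (inverse c) w"]) auto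
  qed (use \<open>c \<noteq> 0\<close> in auto)
  moreover have "open (scl (inverse c) -` D)"
    using open_vimage[OF \<open>open D\<close> continuous_on_scale_right] .
  ultimately show ?thesis by simp
qed

lemma open_dilate:
  assumes "open K" "r > 0"
  shows "open (dilate scl K x r)"
  unfolding dilate_eq_translate using assms by (intro open_translate open_scale) auto

text \<open>A single point is absorbed by a neighbourhood \<open>V\<close> of the origin because \<open>scl (inverse c) x\<close>
  tends
  to \<open>0\<close> as \<open>c\<close> tends to infinity.\<close>
lemma point_absorbed:
  assumes "open V" "0 \<in> V"
  obtains s where "s > 0" "\<And>c. norm c > s \<Longrightarrow> x \<in> scl c ` V"
proof -
  have "open ((\<lambda>c. scl c x) -` V)"
    using open_vimage[OF \<open>open V\<close> continuous_on_scale_left] .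
  moreover have "0 \<in> (\<lambda>c. scl c x) -` V"
    using assms by simp
  ultimately obtain e where "e > 0" "ball 0 e \<subseteq> (\<lambda>c. scl c x) -` V"
    by (rule openE)
  then have e: "e > 0" "norm d < e \<Longrightarrow> scl d x \<in> V" for d
    by auto
  show thesis
  proof (rule that)
    show "1 / e > 0" using e by simp
    fix c :: 'k assume c: "norm c > 1 / e"
    then have "c \<noteq> 0" using e by auto
    moreover have "norm (inverse c) < e"
      unfolding norm_inverse using c e(1) \<open>c \<noteq> 0\<close> by (simp add: field_simps)
    ultimately show "x \<in> scl c ` V"
      using e(2) by (intro image_eqI[where x = "scl (inverse c) x"]) auto
  qed
qed

lemma tvs_bounded_dilate:
  assumes K: "tvs_bounded scl K" and "r > 0"
  shows "tvs_bounded scl (dilate scl K x r)"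
  unfolding tvs_bounded_def
proof (intro allI impI)
  fix U :: "'a set" assume U: "open U \<and> 0 \<in> U"
  \<comment> \<open>Halving the neighbourhood lets one half absorb the centre and the other the scaled set.\<close>
  have "open ((\<lambda>p. fst p + snd p) -` U)"
    by (rule open_vimage) (use U in \<open>auto intro!: continuous_intros\<close>)
  moreover have "(0, 0) \<in> (\<lambda>p. fst p + snd p) -` U"
    using U by simp
  ultimately obtain V W where VW: "open V" "open W" "0 \<in> V" "0 \<in> W"
      and "V \<times> W \<subseteq> (\<lambda>p. fst p + snd p) -` U"
    by (elim open_prod_elim) auto
  then have sum: "v + w \<in> U" if "v \<in> V" "w \<in> W" for v w
    using that by auto
  obtain s where s: "s > 0" "\<And>c. norm c > s \<Longrightarrow> x \<in> scl c ` V"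
    using point_absorbed VW by blast
  obtain t where t: "t > 0" "\<And>c. norm c > t \<Longrightarrow> K \<subseteq> scl c ` W"
    using K VW unfolding tvs_bounded_def by blast
  show "\<exists>s>0. \<forall>c. norm c > s \<longrightarrow> dilate scl K x r \<subseteq> scl c ` U"
  proof (intro exI conjI allI impI subsetI)
    show "max s (r * t) > 0" using s by simp
    fix c :: 'k and y assume c: "norm c > max s (r * t)" and "y \<in> dilate scl K x r"
    then obtain k where k: "k \<in> K" "y = x + scl (of_real r) k"
      by (auto simp: dilate_def)
    obtain v where v: "v \<in> V" "x = scl c v"
      using s(2)[of c] c by auto
    have "norm (c / of_real r) > t"
      using c \<open>r > 0\<close> by (simp add: norm_divide field_simps)
    then obtain w where w: "w \<in> W" "k = scl (c / of_real r) w"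
      using t(2) k by blast
    have "y = scl c (v + w)"
      using k v w \<open>r > 0\<close> by (simp add: scale_right_distrib)
    then show "y \<in> scl c ` U"
      using sum v w by blast
  qed
qed

lemma eventually_dilate_subset:
  assumes K: "tvs_bounded scl K" and U: "open U" "x \<in> U"
  shows "\<forall>\<^sub>F r in at_right 0. dilate scl K x r \<subseteq> U"
proof -
  have "open ((+) (- x) ` U)"
    using U(1) by (rule open_translate)
  moreover have "0 \<in> (+) (- x) ` U"
    using U(2) by (intro image_eqI[where x = x]) auto
  ultimately obtain s where s: "s > 0" "\<And>c. norm c > s \<Longrightarrow> K \<subseteq> scl c ` (+) (- x) ` U"
    using K unfolding tvs_bounded_def by blast
  have sub: "dilate scl K x r \<subseteq> U" if "r > 0" "r < 1 / s" for r
  proof -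
    have "norm (of_real (1 / r) :: 'k) > s"
      unfolding norm_of_real using that s(1) by (simp add: field_simps)
    from s(2)[OF this] have "K \<subseteq> scl (of_real (1 / r)) ` (+) (- x) ` U" .
    then show ?thesis
      using that by (force simp: dilate_def simp flip: of_real_mult)
  qed
  show ?thesis
    unfolding eventually_at_right_field
    using sub s(1) by (intro exI[of _ "1 / s"]) auto
qed

end

section \<open>Convergence of the mode ratio\<close>

lemma mode_ratio_ge_1:
  assumes "b \<le> a" "b < \<infinity>"
  shows "1 \<le> mode_ratio a b"
proof (cases "b = 0")
  case False
  then have "1 = b / b"
    using assms by simp
  also have "\<dots> \<le> a / b"
    by (rule divide_right_mono_ennreal[OF assms(1)])
  finally show ?thesis using False by (simp add: mode_ratio_def)
qed (simp add: mode_ratio_def)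

lemma tendsto_iff_Limsup_le:
  fixes f :: "'a \<Rightarrow> 'b::{complete_linorder, linorder_topology}"
  assumes F: "F \<noteq> bot" and ge: "\<forall>\<^sub>F x in F. l \<le> f x"
  shows "(f \<longlongrightarrow> l) F \<longleftrightarrow> Limsup F f \<le> l"
proof
  assume "(f \<longlongrightarrow> l) F"
  then show "Limsup F f \<le> l"
    by (simp add: lim_imp_Limsup F)
next
  assume le: "Limsup F f \<le> l"
  have "l \<le> Liminf F f"
    using ge by (rule Liminf_bounded)
  with le show "(f \<longlongrightarrow> l) F"
    using Liminf_le_Limsup[OF F, of f] F by (intro Liminf_eq_Limsup) auto
qed

theorem theorem2p5:
  fixes scl :: "'k::real_normed_field \<Rightarrow>
      'a::{topological_ab_group_add, first_countable_topology, t2_space} \<Rightarrow> 'a"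
    and \<mu> :: "'a measure" and K E :: "'a set" and u :: 'a
  assumes "topological_vector_space scl"
    and "sets \<mu> = sets borel"
    and "emeasure \<mu> (space \<mu>) \<noteq> 0"
    and "\<And>B. B \<in> sets borel \<Longrightarrow> tvs_bounded scl B \<Longrightarrow> emeasure \<mu> B < \<infinity>"
    and "open K" and "0 \<in> K" and "tvs_bounded scl K"
    and "closure E = UNIV"
  shows "E_strong_mode scl K \<mu> E u \<longleftrightarrow> strong_mode scl K \<mu> u"
proof -
  interpret topological_vector_space scl by fact
  let ?f = "ball_mass scl K \<mu>"
  define q where "q r = mode_ratio (SUP z. ?f z r) (?f u r)" for r
  have pos: "\<forall>\<^sub>F r in at_right 0. (r::real) > 0"
    by (simp add: eventually_at_right_less)
  have SUP_eq: "(SUP z\<in>(\<lambda>v. u - v) ` E. ?f z r) = (SUP z. ?f z r)" if "r > 0" for r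
    unfolding ball_mass_def dilate_eq_translate
    using that assms by (intro SUP_translates_dense[symmetric] closure_reflect open_scale) auto
  have "\<forall>\<^sub>F r in at_right 0. mode_ratio (SUP z\<in>(\<lambda>v. u - v) ` E. ?f z r) (?f u r) = q r"
    using pos by eventually_elim (simp only: SUP_eq q_def)
  then have E_mode: "E_strong_mode scl K \<mu> E u \<longleftrightarrow> u \<in> msupp \<mu> \<and> Limsup (at_right 0) q \<le> 1"
    unfolding E_strong_mode_def by (simp only: Limsup_eq)
  have mode: "strong_mode scl K \<mu> u \<longleftrightarrow> (q \<longlongrightarrow> 1) (at_right 0)"
    unfolding strong_mode_def q_def ..
  \<comment> \<open>Finiteness excludes \<open>\<infinity> / \<infinity>\<close>, which would make the ratio \<open>0\<close> instead of at least \<open>1\<close>.\<close>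
  have "?f u r < \<infinity>" if "r > 0" for r
    unfolding ball_mass_def using that assms
    by (intro assms(4) tvs_bounded_dilate borel_open open_dilate) auto
  then have "1 \<le> q r" if "r > 0" for r
    unfolding q_def using that by (intro mode_ratio_ge_1 SUP_upper) auto
  with pos have "\<forall>\<^sub>F r in at_right 0. 1 \<le> q r"
    by (rule eventually_mono)
  then have lim: "(q \<longlongrightarrow> 1) (at_right 0) \<longleftrightarrow> Limsup (at_right 0) q \<le> 1"
    by (intro tendsto_iff_Limsup_le) auto
  have supp: "u \<in> msupp \<mu>" if "(q \<longlongrightarrow> 1) (at_right 0)"
    unfolding msupp_def
  proof (intro CollectI allI impI)
    fix U assume U: "open U \<and> u \<in> U"
    have "\<forall>\<^sub>F r in at_right 0. q r < \<infinity>"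
      using that by (rule order_tendstoD) simp
    moreover have "\<forall>\<^sub>F r in at_right 0. dilate scl K u r \<subseteq> U"
      using U assms by (intro eventually_dilate_subset) auto
    ultimately have "\<forall>\<^sub>F r in at_right 0. q r < \<infinity> \<and> dilate scl K u r \<subseteq> U"
      by (rule eventually_conj)
    then obtain r where r: "q r < \<infinity>" "dilate scl K u r \<subseteq> U"
      using eventually_happens'[OF trivial_limit_at_right_real] by blast
    \<comment> \<open>A vanishing denominator would make the ratio infinite.\<close>
    have "0 < ?f u r"
      using r(1) by (auto simp: q_def mode_ratio_def zero_less_iff_neq_zero)
    also have "?f u r \<le> emeasure \<mu> U"
      unfolding ball_mass_def using r(2) U assms(2) by (intro emeasure_mono) auto
    finally show "0 < emeasure \<mu> U" .
  qed
  show ?thesis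
    using E_mode mode lim supp by blast
qed

end
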